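(* Let $R$ be a Noetherian domain and let $I=(f_1,\ldots,f_m)\subset R$ be a non-zero ideal. Let $J$ and $L$ be the ideals of $T=R[y_1,\ldots,y_m]$ consisting of the defining ideal of the Rees algebra of $I$ and the ideal generated by the linear relations, respectively. Then (a) $C(I)\neq 0$; (b) $L:_Tr=J$ for all $r\in C(I)\setminus\{0\}$.
   Context: All rings are commutative with unit. For a Noetherian ring $R$ and an ideal $I=(f_1,\ldots,f_m)\subseteq R$, let $\mathcal{R}(I)=R[f_1t,\ldots,f_mt]\subseteq R[t]$ be the Rees algebra, $T=R[y_1,\ldots,y_m]$ a polynomial ring, $\varphi:T\to\mathcal{R}(I)$ the $R$-algebra homomorphism with $\varphi(y_j)=f_jt$, and $J=\ker\varphi$. Let $L\subseteq J$ be the ideal of $T$ generated by all linear relations $\sum_{i=1}^m a_iy_i$ with $a_i\in R$ and $\sum_i a_if_i=0$. Then $T/L\cong S(I)$ is the symmetric algebra of $I$, and the kernel of the canonical epimorphism $\alpha:S(I)\to\mathcal{R}(I)$ is $J/L$. The conductor of $I$ is the ideal $C(I)=L:_RJ=\{r\in R: rJ\subseteq L\}=\mathrm{Ann}_R(\ker\alpha)$ of $R$; it does not depend on the chosen generators. *)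

theory Defs
  imports "HOL-Library.Poly_Mapping" "HOL-Computational_Algebra.Polynomial"
begin

global_interpretation ideal: module "(*) :: 'a \<Rightarrow> 'a \<Rightarrow> 'a::comm_ring_1"
  by standard (simp_all add: algebra_simps)

text \<open>
  An ideal of a commutative ring is a submodule of the ring regarded as a module over itself:
  \<^term>\<open>ideal.subspace\<close> says that a set is an ideal, and \<^term>\<open>ideal.span\<close> is the ideal
  generated by a set.
\<close>

definition noetherian :: "'a::comm_ring_1 itself \<Rightarrow> bool" where
  "noetherian _ \<longleftrightarrow> (\<forall>I :: 'a set. ideal.subspace I \<longrightarrow> (\<exists>S. finite S \<and> I = ideal.span S))"

text \<open>
  The polynomial ring over \<open>'a\<close> in variables indexed by the finite type \<open>'n\<close>: finitely supported
  functions from exponent vectors to coefficients. Multiplication is convolution.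
\<close>

type_synonym ('n, 'a) mpoly = "('n \<Rightarrow>\<^sub>0 nat) \<Rightarrow>\<^sub>0 'a"

definition const :: "'a::comm_ring_1 \<Rightarrow> ('n, 'a) mpoly" where
  "const a = Poly_Mapping.single 0 a"

definition var :: "'n \<Rightarrow> ('n, 'a::comm_ring_1) mpoly" where
  "var j = Poly_Mapping.single (Poly_Mapping.single j 1) 1"

text \<open>The Rees algebra $R[f_j t : j] \subseteq R[t]$; here \<^term>\<open>monom (f j) 1\<close> is $f_j t$.\<close>

inductive_set rees_algebra :: "('n \<Rightarrow> 'a::comm_ring_1) \<Rightarrow> 'a poly set"
  for f :: "'n \<Rightarrow> 'a" where
  base: "[:a:] \<in> rees_algebra f"
| gen: "monom (f j) 1 \<in> rees_algebra f"
| add: "p \<in> rees_algebra f \<Longrightarrow> q \<in> rees_algebra f \<Longrightarrow> p + q \<in> rees_algebra f"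
| mult: "p \<in> rees_algebra f \<Longrightarrow> q \<in> rees_algebra f \<Longrightarrow> p * q \<in> rees_algebra f"

text \<open>
  Substitution of $f_j t$ for $y_j$. The lemmas below show that it is the homomorphism of algebras
  onto the Rees algebra determined by $y_j \mapsto f_j t$. In the usual notation, its kernel
  \<open>rees_ideal f\<close> is $J$, \<open>linear_ideal f\<close> is $L$, and \<open>conductor f\<close> is $C(I) = L :_R J$ for the
  ideal $I$ generated by the family \<open>f\<close>.
\<close>

definition rees_map :: "('n::finite \<Rightarrow> 'a::comm_ring_1) \<Rightarrow> ('n, 'a) mpoly \<Rightarrow> 'a poly" where
  "rees_map f p = (\<Sum>e \<in> Poly_Mapping.keys p.
     smult (Poly_Mapping.lookup p e) (\<Prod>j\<in>UNIV. monom (f j) 1 ^ Poly_Mapping.lookup e j))"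

definition rees_ideal :: "('n::finite \<Rightarrow> 'a::comm_ring_1) \<Rightarrow> ('n, 'a) mpoly set" where
  "rees_ideal f = {p. rees_map f p = 0}"

definition linear_ideal :: "('n::finite \<Rightarrow> 'a::comm_ring_1) \<Rightarrow> ('n, 'a) mpoly set" where
  "linear_ideal f =
     ideal.span {(\<Sum>j\<in>UNIV. const (a j) * var j) | a. (\<Sum>j\<in>UNIV. a j * f j) = 0}"

definition conductor :: "('n::finite \<Rightarrow> 'a::comm_ring_1) \<Rightarrow> 'a set" where
  "conductor f = {r. \<forall>p \<in> rees_ideal f. const r * p \<in> linear_ideal f}"

definition colon :: "'b::comm_ring_1 set \<Rightarrow> 'b \<Rightarrow> 'b set" where
  "colon K x = {p. x * p \<in> K}"

lemma mpoly_eq_sum_monomials: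
  "p = (\<Sum>e \<in> Poly_Mapping.keys p. Poly_Mapping.single e (Poly_Mapping.lookup p e))"
  by (rule poly_mapping_eqI)
    (auto simp: lookup_sum lookup_single when_def in_keys_iff)

lemma rees_map_superset:
  assumes "finite S" "Poly_Mapping.keys p \<subseteq> S"
  shows "rees_map f p = (\<Sum>e\<in>S.
     smult (Poly_Mapping.lookup p e) (\<Prod>j\<in>UNIV. monom (f j) 1 ^ Poly_Mapping.lookup e j))"
  unfolding rees_map_def
  by (rule sum.mono_neutral_left) (use assms in \<open>auto simp: in_keys_iff\<close>)

lemma rees_map_single:
  "rees_map f (Poly_Mapping.single e a) =
     smult a (\<Prod>j\<in>UNIV. monom (f j) 1 ^ Poly_Mapping.lookup e j)"
  by (subst rees_map_superset[of "{e}"]) auto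

lemma rees_map_zero: "rees_map f 0 = 0"
  by (simp add: rees_map_def)

lemma rees_map_add: "rees_map f (p + q) = rees_map f p + rees_map f q"
proof -
  let ?S = "Poly_Mapping.keys p \<union> Poly_Mapping.keys q"
  have "Poly_Mapping.keys (p + q) \<subseteq> ?S"
    by (rule Poly_Mapping.keys_add)
  then show ?thesis
    by (simp add: rees_map_superset[of ?S] lookup_add smult_add_left sum.distrib)
qed

lemma rees_map_sum: "rees_map f (sum g A) = (\<Sum>x\<in>A. rees_map f (g x))"
  by (induction A rule: infinite_finite_induct) (simp_all add: rees_map_zero rees_map_add)

lemma rees_map_mult: "rees_map f (p * q) = rees_map f p * rees_map f q"
proof -
  have single: "rees_map f (Poly_Mapping.single d a * Poly_Mapping.single e b) =
      rees_map f (Poly_Mapping.single d a) * rees_map f (Poly_Mapping.single e b)" for d e a b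
    by (simp add: mult_single rees_map_single lookup_add power_add prod.distrib mult_ac)
  let ?s = "\<lambda>p e. Poly_Mapping.single e (Poly_Mapping.lookup p e)"
  have "rees_map f (p * q) =
      rees_map f ((\<Sum>d\<in>Poly_Mapping.keys p. ?s p d) * (\<Sum>e\<in>Poly_Mapping.keys q. ?s q e))"
    by (simp flip: mpoly_eq_sum_monomials)
  also have "\<dots> = rees_map f (\<Sum>d\<in>Poly_Mapping.keys p. ?s p d) *
      rees_map f (\<Sum>e\<in>Poly_Mapping.keys q. ?s q e)"
    by (simp only: sum_product rees_map_sum single)
  finally show ?thesis
    by (simp flip: mpoly_eq_sum_monomials)
qed

lemma rees_map_const: "rees_map f (const a) = [:a:]"
  by (simp add: const_def rees_map_single)

lemma rees_map_var: "rees_map f (var j) = monom (f j) 1"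
proof -
  have "(\<Prod>k\<in>UNIV. monom (f k) 1 ^ Poly_Mapping.lookup (Poly_Mapping.single j 1) k) =
      (\<Prod>k\<in>UNIV. if k = j then monom (f k) 1 else 1)"
    by (rule prod.cong) (auto simp: lookup_single when_def)
  then show ?thesis
    by (simp add: var_def rees_map_single)
qed

lemma range_rees_map:
  fixes f :: "'n::finite \<Rightarrow> 'a::comm_ring_1"
  shows "range (rees_map f) = rees_algebra f"
proof (intro equalityI subsetI)
  fix p assume "p \<in> rees_algebra f"
  then show "p \<in> range (rees_map f)"
  proof induction
    case (base a)
    show ?case using rees_map_const[of f a] by (metis rangeI)
  next
    case (gen j)
    show ?case using rees_map_var[of f j] by (metis rangeI)
  next
    case (add p q)
    then show ?case by (auto simp flip: rees_map_add)
  next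
    case (mult p q)
    then show ?case by (auto simp flip: rees_map_mult)
  qed
next
  fix p assume "p \<in> range (rees_map f)"
  then obtain q where p: "p = rees_map f q" by blast
  have one: "1 \<in> rees_algebra f"
    using rees_algebra.base[of 1 f] by (simp add: one_pCons)
  have pow: "g ^ n \<in> rees_algebra f" if "g \<in> rees_algebra f" for g n
    using that by (induction n) (auto intro: one rees_algebra.mult)
  have prd: "prod g A \<in> rees_algebra f" if "\<And>x. g x \<in> rees_algebra f" for g and A :: "'n set"
    using that by (induction A rule: infinite_finite_induct) (auto intro: one rees_algebra.mult)
  have sm: "smult c g \<in> rees_algebra f" if "g \<in> rees_algebra f" for c g
    using rees_algebra.mult[OF rees_algebra.base[of c] that] by simp
  have zero: "0 \<in> rees_algebra f"
    using rees_algebra.base[of 0 f] by simp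
  have sm_sum: "sum g A \<in> rees_algebra f" if "\<And>x. g x \<in> rees_algebra f"
    for g and A :: "('n \<Rightarrow>\<^sub>0 nat) set"
    using that by (induction A rule: infinite_finite_induct) (auto intro: zero rees_algebra.add)
  show "p \<in> rees_algebra f"
    unfolding p rees_map_def by (intro sm_sum sm prd pow rees_algebra.gen)
qed

end

theory Submission
  imports Defs "HOL-Library.List_Lenlexorder"
begin

text \<open>
  Choose \<open>k\<close> with $f_k \neq 0$. Modulo $L$ we have $f_k y_j \equiv f_j y_k$, so $f_k^N p$ is
  congruent to a polynomial in $y_k$ alone whose coefficients are multiples of the coefficients
  of $\varphi(p)$, as soon as $N$ bounds the degree of $p$; hence $f_k^N p \in L$ for $p \in J$.
  By Hilbert's basis theorem $J$ is finitely generated, so one exponent $N$ serves all of $J$, and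
  $f_k^N \in C(I)$. Part (b) holds because $J$ is the kernel of a homomorphism to the domain
  $R[t]$ that is injective on constants.
\<close>

text \<open>For the ring as a module over itself this reads $a (b x) = (a b) x$, which loops with \<open>mult_ac\<close>.\<close>

declare ideal.scale_scale [simp del]

section \<open>Hilbert's basis theorem\<close>

lemma ideal_span_range_bounded:
  fixes a :: "nat \<Rightarrow> 'a::comm_ring_1"
  assumes "x \<in> ideal.span (range a)"
  shows "\<exists>n. x \<in> ideal.span (a ` {..<n})"
  using assms
proof (induction rule: ideal.span_induct_alt)
  case base
  show ?case by (auto intro: ideal.span_zero)
next
  case (step c x y)
  from step(1) obtain i where i: "x = a i" by blast
  from step(2) obtain n where n: "y \<in> ideal.span (a ` {..<n})" by blast
  let ?m = "max n (Suc i)"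
  have "x \<in> ideal.span (a ` {..<?m})"
    unfolding i by (intro ideal.span_base imageI) auto
  moreover have "y \<in> ideal.span (a ` {..<?m})"
    using n ideal.span_mono[of "a ` {..<n}" "a ` {..<?m}"] by fastforce
  ultimately show ?case
    by (blast intro: ideal.span_add ideal.span_scale)
qed

text \<open>A finite generating set of the ideal of the whole sequence already lies in the ideal of
  an initial segment, which then contains every later term.\<close>

lemma noetherian_sequence:
  fixes a :: "nat \<Rightarrow> 'a::comm_ring_1"
  assumes "noetherian TYPE('a)"
  shows "\<exists>n. a n \<in> ideal.span (a ` {..<n})"
proof -
  obtain S where S: "finite S" "ideal.span (range a) = ideal.span S"
    using assms unfolding noetherian_def by (meson ideal.subspace_span)
  have "\<forall>x\<in>S. \<exists>n. x \<in> ideal.span (a ` {..<n})"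
    using S(2) by (metis ideal.span_base ideal_span_range_bounded)
  then obtain h where h: "\<And>x. x \<in> S \<Longrightarrow> x \<in> ideal.span (a ` {..<h x})"
    by metis
  \<comment> \<open>The extra 0 keeps \<open>Max\<close> meaningful when \<open>S\<close> is
    empty.\<close>
  define n where "n = Max (insert 0 (h ` S))"
  have "S \<subseteq> ideal.span (a ` {..<n})"
  proof
    fix x assume "x \<in> S"
    then have "h x \<le> n" unfolding n_def using S(1) by simp
    then have "a ` {..<h x} \<subseteq> a ` {..<n}" by auto
    then show "x \<in> ideal.span (a ` {..<n})"
      using h[OF \<open>x \<in> S\<close>] ideal.span_mono by blast
  qed
  then have "ideal.span (range a) \<subseteq> ideal.span (a ` {..<n})"
    unfolding S(2) by (simp add: ideal.span_minimal)
  then show ?thesis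
    by (meson ideal.span_base rangeI subsetD)
qed

text \<open>Coefficients are attached to indices rather than to values, since \<open>a\<close> may
  repeat values; the induction splits off the last generator.\<close>

lemma ideal_span_image_lessThan:
  fixes a :: "nat \<Rightarrow> 'a::comm_ring_1"
  assumes "x \<in> ideal.span (a ` {..<n})"
  shows "\<exists>s. x = (\<Sum>i<n. s i * a i)"
  using assms
proof (induction n arbitrary: x)
  case 0
  then show ?case by simp
next
  case (Suc n)
  then obtain c where "x - c * a n \<in> ideal.span (a ` {..<n})"
    by (auto simp: lessThan_Suc ideal.span_breakdown_eq)
  with Suc.IH obtain s where s: "x - c * a n = (\<Sum>i<n. s i * a i)" by blast
  have "x = (\<Sum>i<Suc n. (s(n := c)) i * a i)"
    using s by (simp add: algebra_simps)
  then show ?case by blast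
qed

text \<open>Coordinates are treated one at a time: a subsequence good for \<open>A\<close> is
  thinned out further for \<open>x\<close>, which preserves monotonicity on
  \<open>A\<close>.\<close>

lemma dickson_subsequence:
  fixes e :: "nat \<Rightarrow> 'n \<Rightarrow> nat"
  assumes "finite A"
  shows "\<exists>g :: nat \<Rightarrow> nat. strict_mono g \<and> (\<forall>x\<in>A. \<forall>i j. i \<le> j \<longrightarrow> e (g i) x \<le> e (g j) x)"
  using assms
proof induction
  case empty
  show ?case by (intro exI[of _ id]) (simp add: strict_mono_def)
next
  case (insert x A)
  from insert.IH obtain g :: "nat \<Rightarrow> nat" where g: "strict_mono g"
    "\<forall>y\<in>A. \<forall>i j. i \<le> j \<longrightarrow> e (g i) y \<le> e (g j) y" by (elim exE conjE)
  define s where "s i = e (g i) x" for i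
  have "\<exists>h :: nat \<Rightarrow> nat. strict_mono h \<and> (\<forall>i j. i \<le> j \<longrightarrow> s (h i) \<le> s (h j))"
  proof -
    obtain h where h: "strict_mono h" "monoseq (\<lambda>n. s (h n))"
      using seq_monosub[of s] by blast
    show ?thesis
    proof (cases "incseq (\<lambda>n. s (h n))")
      case True
      with h(1) show ?thesis unfolding incseq_def by blast
    next
      case False
      then have dec: "\<And>i j. i \<le> j \<Longrightarrow> s (h j) \<le> s (h i)"
        using h(2) by (auto simp: monoseq_def incseq_def)
      \<comment> \<open>A decreasing sequence of naturals is constant from the first index found
        where its minimum is attained, so a shift by \<open>m\<close> makes it monotone.\<close>
      obtain m where m: "\<And>n. s (h m) \<le> s (h n)"
        using ex_has_least_nat[of "\<lambda>_. True" 0 "\<lambda>n. s (h n)"] by auto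
      have "s (h (m + i)) = s (h m)" for i
        using dec[of m "m + i"] m[of "m + i"] by simp
      moreover have "strict_mono (\<lambda>i. h (m + i))"
        using h(1) by (simp add: strict_mono_def)
      ultimately show ?thesis by (metis order_refl)
    qed
  qed
  then obtain h :: "nat \<Rightarrow> nat" where h: "strict_mono h" "\<forall>i j. i \<le> j \<longrightarrow> s (h i) \<le> s (h j)"
    by (elim exE conjE)
  have "strict_mono (\<lambda>i. g (h i))"
    using g(1) h(1) by (simp add: strict_mono_def)
  moreover have "\<And>i j. i \<le> j \<Longrightarrow> h i \<le> h j"
    using h(1) by (simp add: strict_mono_less_eq)
  ultimately show ?case
    using g(2) h(2) by (intro exI[of _ "\<lambda>i. g (h i)"]) (simp add: s_def)
qed

text \<open>
  The lexicographic order on exponent vectors, with respect to an arbitrary enumeration of the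
  variables, as an embedding into the well-order of lists of natural numbers.
\<close>

definition expo_list :: "('n::finite \<Rightarrow>\<^sub>0 nat) \<Rightarrow> nat list" where
  "expo_list e = map (Poly_Mapping.lookup e) (SOME ns. set ns = UNIV)"

lemma inj_expo_list: "inj expo_list"
proof (rule injI)
  fix d e :: "'n::finite \<Rightarrow>\<^sub>0 nat"
  assume "expo_list d = expo_list e"
  moreover have "set (SOME ns. set ns = (UNIV :: 'n set)) = UNIV"
    by (rule someI_ex) (simp add: finite_list)
  ultimately show "d = e"
    by (intro poly_mapping_eqI) (auto simp: expo_list_def)
qed

text \<open>Compatibility with multiplication by monomials: adding a common vector does not move the
  first position of difference. Lists are compared by length first, but all lists of exponents have
  the same length.\<close>

lemma expo_list_add_mono:
  assumes "expo_list d \<le> expo_list e"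
  shows "expo_list (c + d) \<le> expo_list (c + e)"
proof -
  have "map g xs \<le> map h xs \<Longrightarrow> map (\<lambda>x. k x + g x) xs \<le> map (\<lambda>x. k x + h x) xs"
    for g h k :: "'a \<Rightarrow> nat" and xs
    by (induction xs) (auto simp: Cons_le_Cons)
  moreover have "Poly_Mapping.lookup (c + d) = (\<lambda>x. Poly_Mapping.lookup c x + Poly_Mapping.lookup d x)"
    for c d :: "'a \<Rightarrow>\<^sub>0 nat"
    by (rule ext) (rule lookup_add)
  ultimately show ?thesis
    using assms by (simp add: expo_list_def)
qed

text \<open>The value is a list so that minimal ones exist by well-ordering. At 0 the maximum of the
  empty set is unspecified; elements outside an ideal are never 0.\<close>

definition lead_expo :: "('n::finite, 'a::comm_ring_1) mpoly \<Rightarrow> nat list" where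
  "lead_expo p = Max (expo_list ` Poly_Mapping.keys p)"

lemma expo_list_le_lead_expo: "e \<in> Poly_Mapping.keys p \<Longrightarrow> expo_list e \<le> lead_expo p"
  by (simp add: lead_expo_def)

lemma ex_lead_expo:
  assumes "p \<noteq> 0"
  shows "\<exists>e\<in>Poly_Mapping.keys p. expo_list e = lead_expo p"
proof -
  have "lead_expo p \<in> expo_list ` Poly_Mapping.keys p"
    unfolding lead_expo_def using assms by (intro Max_in) auto
  then show ?thesis by auto
qed

text \<open>Translation of exponents by \<open>d\<close> is injective, so only the term of
  \<open>p\<close> at \<open>k\<close> contributes.\<close>

lemma lookup_single_mult:
  fixes p :: "('n, 'a::comm_ring_1) mpoly"
  shows "Poly_Mapping.lookup (Poly_Mapping.single d c * p) (d + k) = c * Poly_Mapping.lookup p k"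
proof -
  have "Poly_Mapping.single d c * p =
      Poly_Mapping.single d c *
        (\<Sum>e\<in>Poly_Mapping.keys p. Poly_Mapping.single e (Poly_Mapping.lookup p e))"
    by (simp flip: mpoly_eq_sum_monomials)
  also have "\<dots> = (\<Sum>e\<in>Poly_Mapping.keys p. Poly_Mapping.single (d + e) (c * Poly_Mapping.lookup p e))"
    by (simp add: sum_distrib_left mult_single)
  finally show ?thesis
    by (auto simp: lookup_sum lookup_single when_def in_keys_iff)
qed

text \<open>
  If \<open>K\<close> were not finitely generated, one could choose $u_0, u_1, \ldots$ in \<open>K\<close>, each with minimal
  leading exponent among the elements outside the ideal generated by its predecessors. Along a
  subsequence with increasing leading exponents, some leading coefficient is a linear combination
  of earlier ones; cancelling the leading term contradicts minimality.
\<close>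

theorem noetherian_mpoly:
  assumes noeth: "noetherian TYPE('a::comm_ring_1)"
  shows "noetherian TYPE(('n::finite, 'a) mpoly)"
  unfolding noetherian_def
proof (intro allI impI, rule ccontr)
  fix K :: "('n, 'a) mpoly set"
  assume K: "ideal.subspace K" and not_fg: "\<not> (\<exists>S. finite S \<and> K = ideal.span S)"
  have proper: "\<exists>p. p \<in> K - ideal.span F" if "finite F" "F \<subseteq> K" for F
    using not_fg that K ideal.span_minimal[of F K] by blast
  let ?P = "\<lambda>u (n::nat) x. x \<in> K - ideal.span (u ` {..<n}) \<and>
    (\<forall>q\<in>K - ideal.span (u ` {..<n}). lead_expo x \<le> lead_expo q)"
  have "\<exists>u. \<forall>n. ?P u n (u n)"
  \<comment> \<open>Each choice depends on all earlier terms; the first goal says that it depends on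
    nothing else.\<close>
  proof (rule dependent_wellorder_choice)
    fix r and u v :: "nat \<Rightarrow> ('n, 'a) mpoly" and n :: nat
    assume "\<And>y. y < n \<Longrightarrow> u y = v y"
    then have "u ` {..<n} = v ` {..<n}" by (intro image_cong) auto
    then show "?P u n r = ?P v n r" by simp
  next
    fix n :: nat and u :: "nat \<Rightarrow> ('n, 'a) mpoly"
    assume "\<And>y. y < n \<Longrightarrow> ?P u y (u y)"
    then have "u ` {..<n} \<subseteq> K" by auto
    then obtain p where p: "p \<in> K - ideal.span (u ` {..<n})"
      using proper[of "u ` {..<n}"] by auto
    let ?Q = "\<lambda>l. \<exists>p\<in>K - ideal.span (u ` {..<n}). lead_expo p = l"
    have "?Q (LEAST l. ?Q l)" by (rule LeastI[of ?Q "lead_expo p"]) (use p in blast)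
    then obtain r where r: "r \<in> K - ideal.span (u ` {..<n})" "lead_expo r = (LEAST l. ?Q l)"
      by blast
    have "lead_expo r \<le> lead_expo q" if "q \<in> K - ideal.span (u ` {..<n})" for q
      unfolding r(2) by (rule Least_le) (use that in blast)
    with r(1) show "\<exists>r. ?P u n r" by blast
  qed
  then obtain u where u: "\<forall>n. ?P u n (u n)" ..
  then have u_in: "u n \<in> K" "u n \<notin> ideal.span (u ` {..<n})" for n
    by auto
  have u_min: "lead_expo (u n) \<le> lead_expo q" if "q \<in> K" "q \<notin> ideal.span (u ` {..<n})" for n q
    using u that by blast
  have "u n \<noteq> 0" for n
    using u_in(2)[of n] by (metis ideal.span_zero)
  then have "\<forall>n. \<exists>e. e \<in> Poly_Mapping.keys (u n) \<and> expo_list e = lead_expo (u n)"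
    using ex_lead_expo by blast
  from choice[OF this] obtain e where e: "e n \<in> Poly_Mapping.keys (u n)"
    "expo_list (e n) = lead_expo (u n)" for n
    by blast
  obtain g :: "nat \<Rightarrow> nat" where g: "strict_mono g"
    "\<And>x i j. i \<le> j \<Longrightarrow> Poly_Mapping.lookup (e (g i)) x \<le> Poly_Mapping.lookup (e (g j)) x"
    using dickson_subsequence[of "UNIV :: 'n set" "\<lambda>n. Poly_Mapping.lookup (e n)"] by auto
  define a where "a i = Poly_Mapping.lookup (u (g i)) (e (g i))" for i
  obtain n s where s: "a n = (\<Sum>i<n. s i * a i)"
    using noetherian_sequence[OF noeth] ideal_span_image_lessThan by metis
  \<comment> \<open>Subtraction is truncated, but for \<open>i < n\<close> the monotonicity of the
    subsequence makes it exact.\<close>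
  define d where "d i = e (g n) - e (g i)" for i
  have d: "d i + e (g i) = e (g n)" if "i < n" for i
    using g(2)[of i n] that by (intro poly_mapping_eqI) (simp add: d_def lookup_add lookup_minus)
  \<comment> \<open>Shifting by \<open>d i\<close> moves every leading exponent to
    \<open>e (g n)\<close>, where the coefficients add up to \<open>a n\<close>; thus
    \<open>w\<close> cancels the leading term of \<open>u (g n)\<close>.\<close>
  define w where "w = (\<Sum>i<n. Poly_Mapping.single (d i) (s i) * u (g i))"
  have "w \<in> ideal.span (u ` {..<g n})"
    unfolding w_def using g(1)
    by (intro ideal.span_sum ideal.span_scale ideal.span_base) (simp add: strict_mono_def)
  moreover from this have "w \<in> K"
    using ideal.span_minimal[of "u ` {..<g n}" K] K u_in(1) by blast
  ultimately have v: "u (g n) - w \<in> K" "u (g n) - w \<notin> ideal.span (u ` {..<g n})"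
    using K u_in[of "g n"] ideal.span_add[of "u (g n) - w" _ w]
    by (auto intro: ideal.subspace_diff)
  then have "u (g n) - w \<noteq> 0" by (metis ideal.span_zero)
  then obtain k where k: "k \<in> Poly_Mapping.keys (u (g n) - w)"
    "expo_list k = lead_expo (u (g n) - w)"
    using ex_lead_expo by blast
  \<comment> \<open>An exponent of the difference comes from \<open>u (g n)\<close> or from a
    shifted \<open>u (g i)\<close>, and neither exceeds \<open>e (g n)\<close>.\<close>
  have "expo_list k \<le> expo_list (e (g n))"
  proof (cases "k \<in> Poly_Mapping.keys (u (g n))")
    case True
    then show ?thesis by (simp add: e(2) expo_list_le_lead_expo)
  next
    case False
    with k(1) have "Poly_Mapping.lookup w k \<noteq> 0"
      by (simp add: in_keys_iff lookup_minus)
    then have "\<exists>i\<in>{..<n}. Poly_Mapping.lookup (Poly_Mapping.single (d i) (s i) * u (g i)) k \<noteq> 0"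
      unfolding w_def lookup_sum by (meson sum.neutral)
    then obtain i where i: "i < n" "k \<in> Poly_Mapping.keys (Poly_Mapping.single (d i) (s i) * u (g i))"
      by (auto simp: in_keys_iff)
    then obtain l where l: "k = d i + l" "l \<in> Poly_Mapping.keys (u (g i))"
      using keys_mult[of "Poly_Mapping.single (d i) (s i)" "u (g i)"]
      by (auto split: if_splits)
    then have "expo_list l \<le> expo_list (e (g i))"
      by (simp add: e(2) expo_list_le_lead_expo)
    from expo_list_add_mono[OF this, of "d i"] show ?thesis
      by (simp add: l(1) d[OF i(1)])
  qed
  \<comment> \<open>The difference was also a candidate at stage \<open>g n\<close>, so minimality
    gives the reverse inequality.\<close>
  moreover have "expo_list (e (g n)) \<le> expo_list k"
    unfolding e(2) k(2) using v by (rule u_min)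
  ultimately have "k = e (g n)"
    using inj_expo_list by (metis order_antisym injD)
  moreover have "Poly_Mapping.lookup w (e (g n)) = a n"
    unfolding w_def lookup_sum s
  proof (rule sum.cong)
    fix i assume "i \<in> {..<n}"
    then show "Poly_Mapping.lookup (Poly_Mapping.single (d i) (s i) * u (g i)) (e (g n)) = s i * a i"
      using lookup_single_mult[of "d i" "s i" "u (g i)" "e (g i)"] d[of i] by (simp add: a_def)
  qed simp
  ultimately show False
    using k(1) by (simp add: in_keys_iff lookup_minus a_def)
qed

section \<open>Constants and monomials\<close>

lemma const_0 [simp]: "const 0 = 0"
  and const_1 [simp]: "const 1 = 1"
  and const_add: "const (a + b) = const a + const b"
  and const_diff: "const (a - b) = const a - const b"
  and const_mult: "const (a * b) = const a * const b"
  by (simp_all add: const_def single_add single_diff mult_single)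

lemma const_power: "const (a ^ n) = const a ^ n"
  by (induction n) (simp_all add: const_mult)

lemma const_prod: "const (prod g A) = (\<Prod>x\<in>A. const (g x))"
  by (induction A rule: infinite_finite_induct) (simp_all add: const_mult)

lemma single_eq_const_times_prod_var:
  fixes e :: "'n::finite \<Rightarrow>\<^sub>0 nat"
  shows "Poly_Mapping.single e c = const c * (\<Prod>j\<in>UNIV. var j ^ Poly_Mapping.lookup e j)"
proof -
  have var: "var j ^ m = Poly_Mapping.single (Poly_Mapping.single j m) (1::'a)" for j :: 'n and m
    by (induction m) (simp_all add: var_def mult_single flip: single_add)
  have "(\<Prod>j\<in>A. Poly_Mapping.single (d j) (1::'a)) = Poly_Mapping.single (sum d A) 1"
    for d :: "'n \<Rightarrow> 'n \<Rightarrow>\<^sub>0 nat" and A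
    by (induction A rule: infinite_finite_induct) (simp_all add: mult_single)
  moreover have "(\<Sum>j\<in>UNIV. Poly_Mapping.single j (Poly_Mapping.lookup e j)) = e"
    by (rule poly_mapping_eqI) (simp add: lookup_sum lookup_single when_def)
  ultimately show ?thesis
    by (simp add: var const_def mult_single)
qed

abbreviation total_degree :: "('n::finite \<Rightarrow>\<^sub>0 nat) \<Rightarrow> nat" where
  "total_degree e \<equiv> \<Sum>j\<in>UNIV. Poly_Mapping.lookup e j"

lemma rees_map_single_monom:
  fixes f :: "'n::finite \<Rightarrow> 'a::comm_ring_1"
  shows "rees_map f (Poly_Mapping.single e c) =
    monom (c * (\<Prod>j\<in>UNIV. f j ^ Poly_Mapping.lookup e j)) (total_degree e)"
proof -
  have "(\<Prod>j\<in>A. monom (f j) 1 ^ Poly_Mapping.lookup e j) =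
      monom (\<Prod>j\<in>A. f j ^ Poly_Mapping.lookup e j) (\<Sum>j\<in>A. Poly_Mapping.lookup e j)" for A
    by (induction A rule: infinite_finite_induct)
      (simp_all add: monom_power mult_monom monom_0 one_pCons)
  then show ?thesis
    by (simp add: rees_map_single smult_monom)
qed

section \<open>Congruences modulo the linear relations\<close>

lemma ideal_cong_mult:
  fixes K :: "'b::comm_ring_1 set"
  assumes "ideal.subspace K" "x - y \<in> K" "x' - y' \<in> K"
  shows "x * x' - y * y' \<in> K"
proof -
  have "x * x' - y * y' = x * (x' - y') + y' * (x - y)"
    by (simp add: algebra_simps)
  then show ?thesis
    using assms by (simp add: ideal.subspace_add ideal.subspace_scale)
qed

lemma ideal_cong_power:
  fixes K :: "'b::comm_ring_1 set"
  assumes "ideal.subspace K" "x - y \<in> K"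
  shows "x ^ n - y ^ n \<in> K"
  using assms by (induction n) (simp_all add: ideal.subspace_0 ideal_cong_mult)

lemma ideal_cong_prod:
  fixes K :: "'b::comm_ring_1 set"
  assumes "ideal.subspace K" "\<And>i. i \<in> A \<Longrightarrow> g i - h i \<in> K"
  shows "prod g A - prod h A \<in> K"
  using assms(2)
  by (induction A rule: infinite_finite_induct) (simp_all add: assms(1) ideal.subspace_0 ideal_cong_mult)

section \<open>The ideals $L$ and $J$ and the Koszul relations\<close>

lemma subspace_linear_ideal: "ideal.subspace (linear_ideal f)"
  by (simp add: linear_ideal_def)

lemma subspace_rees_ideal: "ideal.subspace (rees_ideal f)"
  by (simp add: ideal.subspace_def rees_ideal_def rees_map_zero rees_map_add rees_map_mult)

lemma linear_ideal_subset_rees_ideal: "linear_ideal f \<subseteq> rees_ideal f"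
  unfolding linear_ideal_def
proof (rule ideal.span_minimal[OF _ subspace_rees_ideal])
  have "rees_map f (\<Sum>j\<in>UNIV. const (a j) * var j) = monom (\<Sum>j\<in>UNIV. a j * f j) 1" for a
    by (simp add: rees_map_sum rees_map_mult rees_map_const rees_map_var smult_monom
        flip: monom_sum)
  then show "{(\<Sum>j\<in>UNIV. const (a j) * var j) | a. (\<Sum>j\<in>UNIV. a j * f j) = 0} \<subseteq> rees_ideal f"
    by (auto simp: rees_ideal_def)
qed

lemma koszul_relation_in_linear_ideal:
  fixes f :: "'n::finite \<Rightarrow> 'a::comm_ring_1"
  shows "const (f k) * var j - const (f j) * var k \<in> linear_ideal f"
proof -
  \<comment> \<open>A difference of two indicators, so that the case \<open>j = k\<close> yields the
    zero relation without a case split.\<close>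
  define a where "a i = (if i = j then f k else 0) - (if i = k then f j else 0)" for i
  have "(\<Sum>i\<in>UNIV. a i * f i) = 0"
    by (simp add: a_def left_diff_distrib sum_subtractf if_distrib[of "\<lambda>x. x * _"] cong: if_cong)
  moreover have "(\<Sum>i\<in>UNIV. const (a i) * var i) = const (f k) * var j - const (f j) * var k"
    by (simp add: a_def const_diff left_diff_distrib sum_subtractf if_distrib[of const]
        if_distrib[of "\<lambda>x. x * _"] cong: if_cong)
  ultimately show ?thesis
    unfolding linear_ideal_def by (intro ideal.span_base) force
qed

text \<open>For $q = \varphi(p)$ this is $f_k^N$ times the image of $q$ under $t \mapsto y_k / f_k$.\<close>

definition rehomogenize :: "nat \<Rightarrow> 'a::comm_ring_1 \<Rightarrow> 'n \<Rightarrow> 'a poly \<Rightarrow> ('n, 'a) mpoly" where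
  "rehomogenize N c k q = (\<Sum>d\<le>N. const (coeff q d * c ^ (N - d)) * var k ^ d)"

lemma rehomogenize_0: "rehomogenize N c k 0 = 0"
  by (simp add: rehomogenize_def)

lemma rehomogenize_sum:
  "rehomogenize N c k (sum g A) = (\<Sum>x\<in>A. rehomogenize N c k (g x))"
proof -
  have "rehomogenize N c k (p + q) = rehomogenize N c k p + rehomogenize N c k q" for p q
    by (simp add: rehomogenize_def const_add algebra_simps sum.distrib)
  then show ?thesis
    by (induction A rule: infinite_finite_induct) (simp_all add: rehomogenize_0)
qed

lemma rehomogenize_monom:
  assumes "d \<le> N"
  shows "rehomogenize N c k (monom b d) = const (b * c ^ (N - d)) * var k ^ d"
proof -
  have "rehomogenize N c k (monom b d) =
      (\<Sum>i\<le>N. if i = d then const (b * c ^ (N - d)) * var k ^ d else 0)"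
    unfolding rehomogenize_def by (rule sum.cong) auto
  then show ?thesis using assms by simp
qed

text \<open>One factor $f_k$ is given to each variable of the monomial, and every $f_k y_j$ is
  exchanged for $f_j y_k$ by a Koszul relation.\<close>

lemma power_times_single_cong:
  fixes f :: "'n::finite \<Rightarrow> 'a::comm_ring_1"
  assumes "total_degree e \<le> N"
  shows "const (f k ^ N) * Poly_Mapping.single e c -
    rehomogenize N (f k) k (rees_map f (Poly_Mapping.single e c)) \<in> linear_ideal f"
proof -
  let ?d = "total_degree e" and ?l = "Poly_Mapping.lookup e"
  \<comment> \<open>The coefficient together with the factors $f_k$ left over after each variable
    has received one.\<close>
  define b :: "('n, 'a) mpoly" where "b = const (c * f k ^ (N - ?d))"
  have "(\<Prod>j\<in>UNIV. (const (f k) * var j) ^ ?l j) -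
      (\<Prod>j\<in>UNIV. (const (f j) * var k) ^ ?l j) \<in> linear_ideal f"
    by (intro ideal_cong_prod ideal_cong_power koszul_relation_in_linear_ideal subspace_linear_ideal)
  then have "b * ((\<Prod>j\<in>UNIV. (const (f k) * var j) ^ ?l j) -
      (\<Prod>j\<in>UNIV. (const (f j) * var k) ^ ?l j)) \<in> linear_ideal f"
    by (intro ideal.subspace_scale subspace_linear_ideal)
  moreover have "b * (\<Prod>j\<in>UNIV. (const (f k) * var j) ^ ?l j) =
      const (f k ^ N) * Poly_Mapping.single e c"
  proof -
    have "const (f k ^ N) = const (f k ^ (N - ?d)) * (\<Prod>j\<in>UNIV. const (f k) ^ ?l j)"
      using assms by (simp add: const_power flip: power_add power_sum)
    from arg_cong[OF this, of "\<lambda>x. x * Poly_Mapping.single e c"] show ?thesis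
      by (simp add: b_def single_eq_const_times_prod_var power_mult_distrib prod.distrib const_mult mult_ac)
  qed
  moreover have "b * (\<Prod>j\<in>UNIV. (const (f j) * var k) ^ ?l j) =
      rehomogenize N (f k) k (rees_map f (Poly_Mapping.single e c))"
    by (simp add: b_def rees_map_single_monom rehomogenize_monom[OF assms] power_mult_distrib
        prod.distrib const_mult const_power const_prod power_sum mult_ac)
  ultimately show ?thesis
    by (simp add: right_diff_distrib)
qed

lemma power_times_rees_ideal_in_linear_ideal:
  fixes f :: "'n::finite \<Rightarrow> 'a::comm_ring_1"
  assumes "p \<in> rees_ideal f" and N: "\<And>e. e \<in> Poly_Mapping.keys p \<Longrightarrow> total_degree e \<le> N"
  shows "const (f k ^ N) * p \<in> linear_ideal f"
proof -
  let ?K = "Poly_Mapping.keys p"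
  let ?s = "\<lambda>e. Poly_Mapping.single e (Poly_Mapping.lookup p e)"
  have "(\<Sum>e\<in>?K. const (f k ^ N) * ?s e - rehomogenize N (f k) k (rees_map f (?s e))) \<in> linear_ideal f"
    by (intro ideal.subspace_sum subspace_linear_ideal power_times_single_cong N)
  moreover have "(\<Sum>e\<in>?K. rehomogenize N (f k) k (rees_map f (?s e))) = 0"
    using assms(1) unfolding rees_ideal_def
    by (simp add: rehomogenize_0 flip: rehomogenize_sum rees_map_sum mpoly_eq_sum_monomials)
  ultimately show ?thesis
    by (simp add: sum_subtractf flip: sum_distrib_left mpoly_eq_sum_monomials)
qed

section \<open>Non-zero elements of the conductor and colon ideals\<close>

lemma ex_power_in_conductor:
  fixes f :: "'n::finite \<Rightarrow> 'a::comm_ring_1"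
  assumes "noetherian TYPE('a)"
  shows "\<exists>N. f k ^ N \<in> conductor f"
proof -
  obtain S where S: "finite S" "rees_ideal f = ideal.span S"
    using noetherian_mpoly[OF assms, where 'n = 'n] subspace_rees_ideal[of f] unfolding noetherian_def by blast
  define N where "N = Max (insert 0 (total_degree ` (\<Union>p\<in>S. Poly_Mapping.keys p)))"
  have N: "total_degree e \<le> N" if "p \<in> S" "e \<in> Poly_Mapping.keys p" for p e
    unfolding N_def using S(1) that by (intro Max_ge) auto
  have "S \<subseteq> colon (linear_ideal f) (const (f k ^ N))"
    using S(2) N power_times_rees_ideal_in_linear_ideal[of _ f N k]
    by (auto simp: colon_def ideal.span_base)
  \<comment> \<open>Since the colon is an ideal, it suffices that it contains the generators of
    $J$.\<close>
  moreover have "ideal.subspace (colon (linear_ideal f) (const (f k ^ N)))"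
    using subspace_linear_ideal[of f]
    by (auto simp: ideal.subspace_def colon_def distrib_left mult.left_commute)
  ultimately have "rees_ideal f \<subseteq> colon (linear_ideal f) (const (f k ^ N))"
    unfolding S(2) by (rule ideal.span_minimal)
  then show ?thesis
    by (auto simp: conductor_def colon_def)
qed

theorem proposition1p2:
  fixes f :: "'n::finite \<Rightarrow> 'a::idom" and I :: "'a set"
  assumes "noetherian TYPE('a)"
    and "I = ideal.span (range f)"
    and "I \<noteq> {0}"
  shows "conductor f \<noteq> {0} \<and>
    (\<forall>r \<in> conductor f - {0}. colon (linear_ideal f) (const r) = rees_ideal f)"
proof (intro conjI ballI)
  have "\<exists>k. f k \<noteq> 0"
  proof (rule ccontr)
    assume "\<nexists>k. f k \<noteq> 0"
    then have "range f \<subseteq> {0}" by auto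
    then have "ideal.span (range f) \<subseteq> {0}"
      by (intro ideal.span_minimal) (auto simp: ideal.subspace_def)
    with assms(2,3) show False
      using ideal.span_zero by blast
  qed
  then obtain k where "f k \<noteq> 0" by blast
  moreover obtain N where "f k ^ N \<in> conductor f"
    using ex_power_in_conductor[OF assms(1)] by blast
  ultimately show "conductor f \<noteq> {0}" by (metis power_not_zero singletonD)
next
  fix r assume r: "r \<in> conductor f - {0}"
  have "p \<in> rees_ideal f" if "const r * p \<in> linear_ideal f" for p
  proof -
    have "rees_map f (const r * p) = 0"
      using that linear_ideal_subset_rees_ideal by (auto simp: rees_ideal_def)
    then show ?thesis
      using r by (simp add: rees_map_mult rees_map_const rees_ideal_def)
  qed
  with r show "colon (linear_ideal f) (const r) = rees_ideal f"
    by (auto simp: colon_def conductor_def)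
qed

end
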